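(* Let $n\in\mathbb{N}$, let $\mathbb{Z}^n=\langle x_1,\ldots,x_n\mid [x_i,x_j]\text{ whenever }i\neq j\rangle$, and let $G=\mathbb{Z}^n\rtimes_\phi \mathbb{Z}/2\mathbb{Z}$, where either (1) $\phi(x_i)=x_i^{-1}$ for some $i\in\{1,\ldots,n\}$ and $\phi(x_k)=x_k$ for all $k\in\{1,\ldots,n\}\setminus\{i\}$, or (2) $\phi(x_i)=x_j$ for some $i,j\in\{1,\ldots,n\}$ with $i\neq j$ and $\phi(x_k)=x_k$ for all $k\in\{1,\ldots,n\}\setminus\{i,j\}$. Then for every finite symmetric generating set $A$ of $G$, the geodesic language $\mathsf{Geo}(G,A)$ is not piecewise excluding. Moreover, for every such $A$ there is a geodesic word over $A$ containing both a generator and its inverse.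
   Context: Here $[x,y]=xyx^{-1}y^{-1}$, and $\phi$ denotes the automorphism of $\mathbb{Z}^n$ by which the nontrivial element of $\mathbb{Z}/2\mathbb{Z}$ acts in the semidirect product (so $\phi^2=\mathrm{id}$; in case (2) this forces $\phi(x_j)=x_i$). A generating set $A$ of a group $G$ is symmetric if it is inverse-closed: $A$ is a subset of $G$ generating $G$ and $a\in A$ implies $a^{-1}\in A$ (the identity element is allowed to belong to $A$). $A^*$ denotes the set of all finite words over the alphabet $A$, including the empty word. A word $w\in A^*$ is geodesic if it labels a path of minimal length between two vertices of the Cayley graph of $G$ over $A$; equivalently, no strictly shorter word over $A$ represents the same element of $G$ as $w$. The geodesic language $\mathsf{Geo}(G,A)\subseteq A^*$ is the set of all geodesic words. A word $a_1a_2\cdots a_n$ ($a_i\in A$) is a piecewise subword of $w\in A^*$ if $w=w_0a_1w_1a_2\cdots a_nw_n$ for some $w_i\in A^*$ (i.e. it is a not necessarily contiguous subsequence of $w$). A language $L\subseteq A^*$ is piecewise excluding if there is a finite set $F\subset A^*$ such that, for all $w\in A^*$, $w\in L$ if and only if $w$ contains no piecewise subword in $F$. *)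

theory Defs
  imports "HOL-Algebra.Algebra" "HOL-Library.Sublist"
begin

text \<open>The free abelian group on \<open>x\<^sub>1, \<dots>, x\<^sub>n\<close>; the generator \<open>x\<^sub>i\<close> is \<open>frag_of i\<close>.\<close>

abbreviation free_abelian_rank :: "nat \<Rightarrow> (nat \<Rightarrow>\<^sub>0 int) monoid"
  where "free_abelian_rank n \<equiv> free_Abelian_group {1..n}"

text \<open>The outer semidirect product for a homomorphism \<open>\<theta>\<close> from \<open>H\<close> to the automorphism
  group of \<open>N\<close>.\<close>

definition semidirect_product ::
  "('a, 'c) monoid_scheme \<Rightarrow> ('b, 'd) monoid_scheme \<Rightarrow> ('b \<Rightarrow> 'a \<Rightarrow> 'a) \<Rightarrow> ('a \<times> 'b) monoid"
  where "semidirect_product N H \<theta> =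
    \<lparr>carrier = carrier N \<times> carrier H,
     monoid.mult = (\<lambda>(x, h) (y, k). (x \<otimes>\<^bsub>N\<^esub> \<theta> h y, h \<otimes>\<^bsub>H\<^esub> k)),
     one = (\<one>\<^bsub>N\<^esub>, \<one>\<^bsub>H\<^esub>)\<rparr>"

lemma carrier_semidirect_product [simp]:
  "carrier (semidirect_product N H \<theta>) = carrier N \<times> carrier H"
  by (simp add: semidirect_product_def)

lemma mult_semidirect_product [simp]:
  "(x, h) \<otimes>\<^bsub>semidirect_product N H \<theta>\<^esub> (y, k) = (x \<otimes>\<^bsub>N\<^esub> \<theta> h y, h \<otimes>\<^bsub>H\<^esub> k)"
  by (simp add: semidirect_product_def)

lemma one_semidirect_product [simp]:
  "\<one>\<^bsub>semidirect_product N H \<theta>\<^esub> = (\<one>\<^bsub>N\<^esub>, \<one>\<^bsub>H\<^esub>)"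
  by (simp add: semidirect_product_def)

lemma group_semidirect_product:
  assumes "group N" "group H" and \<theta>: "\<theta> \<in> hom H (AutoGroup N)"
  shows "group (semidirect_product N H \<theta>)"
proof -
  interpret N: group N by fact
  interpret H: group H by fact
  have aut: "\<theta> h \<in> hom N N" "\<theta> h \<in> Bij (carrier N)" if "h \<in> carrier H" for h
    using hom_in_carrier[OF \<theta> that] by (auto simp: AutoGroup_def auto_def)
  have closed: "\<theta> h x \<in> carrier N" if "h \<in> carrier H" "x \<in> carrier N" for h x
    using aut(1)[OF that(1)] that(2) by (rule hom_in_carrier)
  have mult: "\<theta> h (x \<otimes>\<^bsub>N\<^esub> y) = \<theta> h x \<otimes>\<^bsub>N\<^esub> \<theta> h y"
    if "h \<in> carrier H" "x \<in> carrier N" "y \<in> carrier N" for h x y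
    using aut(1)[OF that(1)] that(2,3) by (rule hom_mult)
  have comp: "\<theta> (h \<otimes>\<^bsub>H\<^esub> k) x = \<theta> h (\<theta> k x)"
    if "h \<in> carrier H" "k \<in> carrier H" "x \<in> carrier N" for h k x
    using hom_mult[OF \<theta> that(1,2)] aut that
    by (simp add: AutoGroup_def BijGroup_def compose_def)
  have one: "\<theta> \<one>\<^bsub>H\<^esub> x = x" if "x \<in> carrier N" for x
    using hom_one[OF \<theta> H.is_group N.AutoGroup] that
    by (simp add: AutoGroup_def BijGroup_def)
  show ?thesis
  proof (rule groupI)
    fix p assume "p \<in> carrier (semidirect_product N H \<theta>)"
    then obtain x h where p: "p = (x, h)" "x \<in> carrier N" "h \<in> carrier H" by auto
    let ?q = "(\<theta> (inv\<^bsub>H\<^esub> h) (inv\<^bsub>N\<^esub> x), inv\<^bsub>H\<^esub> h)"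
    have "\<theta> (inv\<^bsub>H\<^esub> h) (inv\<^bsub>N\<^esub> x) \<otimes>\<^bsub>N\<^esub> \<theta> (inv\<^bsub>H\<^esub> h) x = \<theta> (inv\<^bsub>H\<^esub> h) \<one>\<^bsub>N\<^esub>"
      using p by (simp flip: mult)
    also have "\<dots> = \<one>\<^bsub>N\<^esub>"
      using aut(1)[of "inv\<^bsub>H\<^esub> h"] p by (simp add: hom_one \<open>group N\<close>)
    finally have "?q \<otimes>\<^bsub>semidirect_product N H \<theta>\<^esub> p = \<one>\<^bsub>semidirect_product N H \<theta>\<^esub>"
      using p by simp
    then show "\<exists>q\<in>carrier (semidirect_product N H \<theta>).
        q \<otimes>\<^bsub>semidirect_product N H \<theta>\<^esub> p = \<one>\<^bsub>semidirect_product N H \<theta>\<^esub>"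
      using p closed by (intro bexI[of _ ?q]) auto
  qed (auto simp: closed mult comp one N.m_assoc H.m_assoc)
qed

definition symmetric_generating_set :: "('a, 'b) monoid_scheme \<Rightarrow> 'a set \<Rightarrow> bool"
  where "symmetric_generating_set G A \<longleftrightarrow>
    A \<subseteq> carrier G \<and> generate G A = carrier G \<and> (\<forall>a\<in>A. inv\<^bsub>G\<^esub> a \<in> A)"

text \<open>In the Cayley graph of \<open>G\<close> over \<open>A\<close>, with an edge labelled \<open>a\<close> from \<open>g\<close> to \<open>g a\<close> for all
  \<open>g \<in> G\<close> and \<open>a \<in> A\<close>, the word \<open>w\<close> labels exactly one path starting at \<open>g\<close>.
  This is the end vertex of that path.\<close>

definition path_end :: "('a, 'b) monoid_scheme \<Rightarrow> 'a \<Rightarrow> 'a list \<Rightarrow> 'a"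
  where "path_end G g w = foldl (\<otimes>\<^bsub>G\<^esub>) g w"

definition Geo :: "('a, 'b) monoid_scheme \<Rightarrow> 'a set \<Rightarrow> 'a list set"
  where "Geo G A = {w \<in> lists A. \<exists>g\<in>carrier G.
    \<forall>v\<in>lists A. path_end G g v = path_end G g w \<longrightarrow> length w \<le> length v}"

lemma (in group) path_end_eq:
  assumes "g \<in> carrier G" "set w \<subseteq> carrier G"
  shows "path_end G g w = g \<otimes> path_end G \<one> w" and "path_end G \<one> w \<in> carrier G"
proof -
  have "path_end G (g \<otimes> h) w = g \<otimes> path_end G h w \<and> path_end G h w \<in> carrier G"
    if "h \<in> carrier G" for h
    using that assms by (induction w arbitrary: h) (auto simp: path_end_def m_assoc)
  from this[of \<one>] show "path_end G g w = g \<otimes> path_end G \<one> w" "path_end G \<one> w \<in> carrier G"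
    using assms(1) by simp_all
qed

text \<open>A word is geodesic iff no strictly shorter word represents the same group element.\<close>

lemma (in group) mem_Geo_iff:
  assumes "A \<subseteq> carrier G"
  shows "w \<in> Geo G A \<longleftrightarrow> w \<in> lists A \<and>
    \<not> (\<exists>v\<in>lists A. length v < length w \<and> path_end G \<one> v = path_end G \<one> w)"
proof -
  have "path_end G g v = path_end G g w \<longleftrightarrow> path_end G \<one> v = path_end G \<one> w"
    if "g \<in> carrier G" "v \<in> lists A" "w \<in> lists A" for g v
  proof -
    have "set v \<subseteq> carrier G" "set w \<subseteq> carrier G"
      using that assms by (auto simp: in_lists_conv_set)
    then show ?thesis
      using that(1) path_end_eq[of g v] path_end_eq[of g w] by simp
  qed
  then show ?thesis
    unfolding Geo_def using one_closed by (auto simp: not_less)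
qed

definition piecewise_excluding :: "'a set \<Rightarrow> 'a list set \<Rightarrow> bool"
  where "piecewise_excluding A L \<longleftrightarrow>
    (\<exists>F. finite F \<and> F \<subseteq> lists A \<and>
      (\<forall>w\<in>lists A. w \<in> L \<longleftrightarrow> \<not> (\<exists>u\<in>F. subseq u w)))"

text \<open>Two different positions of the word are required, so that a single occurrence of a
  generator of order two does not count as an occurrence of it together with its inverse.\<close>

definition contains_generator_and_inverse :: "('a, 'b) monoid_scheme \<Rightarrow> 'a list \<Rightarrow> bool"
  where "contains_generator_and_inverse G w \<longleftrightarrow>
    (\<exists>p<length w. \<exists>q<length w. p \<noteq> q \<and> w ! q = inv\<^bsub>G\<^esub> (w ! p))"

end

theory Submission
  imports Defs
begin

text \<open>In both cases \<open>\<phi>\<close> is a reflection of \<open>\<int>\<^sup>n\<close>, so there is an additive \<open>h : \<int>\<^sup>n \<rightarrow> \<int>\<close> with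
  \<open>h \<circ> \<phi> = - h\<close> and \<open>h x\<^sub>i = 1\<close>. It induces a homomorphism from \<open>G\<close> onto the infinite dihedral
  group, under which a flip, that is an element outside \<open>\<int>\<^sup>n\<close>, has the same image as its inverse.
  Let \<open>M\<close> be the maximum of \<open>h\<close> on the translations in \<open>A\<close>, let \<open>p\<close> and \<open>q\<close> be its maximum and
  minimum on the flips in \<open>A\<close>, attained at \<open>f\<close> and \<open>g\<close>, and let \<open>K = max (2 M) (p - q) > 0\<close>. A word
  of length \<open>m\<close> with an odd number of flips has value at most \<open>p + (m - 1) K / 2\<close> under \<open>h\<close>.
  Hence, if \<open>K = 2 M = 2 h(v)\<close> then \<open>v f v\<^sup>-\<^sup>1\<close> is geodesic, and if \<open>K = p - q\<close> then \<open>f g f\<^sup>-\<^sup>1\<close> is.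
  Since \<open>a a\<^sup>-\<^sup>1\<close> is never geodesic and piecewise excluding languages are closed under piecewise
  subwords, the first claim follows from the second.\<close>

lemma path_end_Nil [simp]: "path_end G g [] = g"
  by (simp add: path_end_def)

lemma path_end_snoc [simp]: "path_end G g (w @ [a]) = path_end G g w \<otimes>\<^bsub>G\<^esub> a"
  by (simp add: path_end_def)

lemma path_end_append: "path_end G g (v @ w) = path_end G (path_end G g v) w"
  by (simp add: path_end_def)

text \<open>Since \<open>A\<close> is closed under inverses, the inverse of a generator is itself a
  letter, so words over \<open>A\<close> already reach the whole generated subgroup.\<close>

lemma (in group) generate_path_end:
  assumes "A \<subseteq> carrier G" "\<And>a. a \<in> A \<Longrightarrow> inv a \<in> A" "x \<in> generate G A"
  shows "\<exists>w\<in>lists A. path_end G \<one> w = x"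
  using assms(3)
proof (induction x rule: generate.induct)
  case one
  then show ?case by (intro bexI[of _ "[]"]) auto
next
  case (incl a)
  then show ?case using assms(1) by (intro bexI[of _ "[a]"]) (auto simp: path_end_def)
next
  case (inv a)
  then show ?case using assms(1) assms(2)[of a] by (intro bexI[of _ "[inv a]"]) (auto simp: path_end_def)
next
  case (eng x y)
  then obtain v w where "v \<in> lists A" "path_end G \<one> v = x" "w \<in> lists A" "path_end G \<one> w = y"
    by blast
  moreover from this have "set v \<subseteq> carrier G" "set w \<subseteq> carrier G"
    using assms(1) by (auto simp: in_lists_conv_set)
  ultimately show ?case
    using path_end_eq[of x w] path_end_eq(2)[of \<one> v]
    by (intro bexI[of _ "v @ w"]) (auto simp: path_end_append)
qed

lemma (in group) not_piecewise_excluding_Geo: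
  assumes "A \<subseteq> carrier G" "w \<in> Geo G A" "contains_generator_and_inverse G w"
  shows "\<not> piecewise_excluding A (Geo G A)"
proof
  assume "piecewise_excluding A (Geo G A)"
  then obtain F where F: "\<forall>v\<in>lists A. v \<in> Geo G A \<longleftrightarrow> \<not> (\<exists>u\<in>F. subseq u v)"
    unfolding piecewise_excluding_def by (elim exE conjE)
  have wA: "w \<in> lists A" using assms(2) by (simp add: Geo_def)
  \<comment> \<open>The two positions come unordered; once they are ordered as \<open>i < j\<close>,
    either letter may be the one given as the inverse.\<close>
  obtain i j where ij: "i < j" "j < length w" "w ! j = inv (w ! i) \<or> w ! i = inv (w ! j)"
    using assms(3) unfolding contains_generator_and_inverse_def by (metis less_linear)
  have A: "w ! i \<in> A" "w ! j \<in> A" using wA ij by (auto simp: in_lists_conv_set)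
  then have carr: "w ! i \<in> carrier G" "w ! j \<in> carrier G" using assms(1) by auto
  have cancel: "w ! i \<otimes> w ! j = \<one>" using ij(3) carr by auto
  have "w ! i \<in> set (take j w)"
    unfolding in_set_conv_nth using ij by (intro exI[of _ i]) simp
  then have "subseq [w ! i] (take j w)" by (simp add: subseq_singleton_left)
  moreover have "subseq [w ! j] (drop j w)"
    using ij Cons_nth_drop_Suc[of j w] by (metis subseq_singleton_left list.set_intros(1))
  ultimately have "subseq ([w ! i] @ [w ! j]) (take j w @ drop j w)"
    by (rule list_emb_append_mono)
  then have sub: "subseq [w ! i, w ! j] w" by simp
  have "\<not> (\<exists>u\<in>F. subseq u [w ! i, w ! j])"
    using F wA assms(2) subseq_order.trans[OF _ sub] by blast
  then have "[w ! i, w ! j] \<in> Geo G A"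
    using F A by simp
  moreover have "path_end G \<one> [] = path_end G \<one> [w ! i, w ! j]"
    using cancel carr by (simp add: path_end_def)
  ultimately show False
    using mem_Geo_iff[OF assms(1), of "[w ! i, w ! j]"]
    by (metis length_greater_0_conv list.simps(3) list.size(3) lists.Nil)
qed

text \<open>The hypotheses say that \<open>g \<mapsto> (h g, flip g)\<close> is a homomorphism to the infinite dihedral group.\<close>

lemma (in group) Geo_contains_generator_and_inverse:
  fixes flip :: "'a \<Rightarrow> bool" and h :: "'a \<Rightarrow> int"
  assumes flip: "\<And>x y. x \<in> carrier G \<Longrightarrow> y \<in> carrier G \<Longrightarrow> flip (x \<otimes> y) \<longleftrightarrow> flip x \<noteq> flip y"
    and h: "\<And>x y. x \<in> carrier G \<Longrightarrow> y \<in> carrier G \<Longrightarrow>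
      h (x \<otimes> y) = h x + (if flip x then - h y else h y)"
    and "x0 \<in> carrier G" "flip x0"
    and "y0 \<in> carrier G" "\<not> flip y0" "h y0 \<noteq> 0"
    and "finite A" and A: "symmetric_generating_set G A"
  shows "\<exists>w\<in>Geo G A. contains_generator_and_inverse G w"
proof -
  have AG: "A \<subseteq> carrier G" and Ainv: "\<And>a. a \<in> A \<Longrightarrow> inv a \<in> A" and gen: "generate G A = carrier G"
    using A by (auto simp: symmetric_generating_set_def)
  have flip_one: "\<not> flip \<one>" using flip[of \<one> \<one>] by simp
  have h_one: "h \<one> = 0" using h[of \<one> \<one>] flip_one by simp
  have flip_inv: "flip (inv x) \<longleftrightarrow> flip x" if "x \<in> carrier G" for x
    using flip[of x "inv x"] that flip_one by simp
  have h_inv: "h (inv x) = (if flip x then h x else - h x)" if "x \<in> carrier G" for x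
    using h[of x "inv x"] that h_one by (auto split: if_splits)
  have word: "\<exists>w\<in>lists A. path_end G \<one> w = x" if "x \<in> carrier G" for x
    using generate_path_end[of A x] AG Ainv gen that by simp
  have closed: "path_end G \<one> w \<in> carrier G" if "w \<in> lists A" for w
    using path_end_eq(2)[of \<one> w] that AG by (auto simp: in_lists_conv_set)
  let ?F = "{a \<in> A. flip a}" and ?T = "{a \<in> A. \<not> flip a}"
  have "?F \<noteq> {}"
  proof
    assume empty: "?F = {}"
    have "\<not> flip (path_end G \<one> w)" if "w \<in> lists A" for w
      using that
    proof (induction w rule: rev_induct)
      case (snoc a w)
      then show ?case using flip[OF closed, of w a] empty AG by auto
    qed (simp add: flip_one)
    with word[OF \<open>x0 \<in> carrier G\<close>] \<open>flip x0\<close> show False by blast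
  qed
  define p q where "p = Max (h ` ?F)" and "q = Min (h ` ?F)"
  \<comment> \<open>The inserted 0 keeps the maximum defined if \<open>A\<close> has no translation
    and gives \<open>0 \<le> M\<close>; if \<open>M > 0\<close>, it is attained at an actual
    translation.\<close>
  define M where "M = Max (insert 0 (h ` ?T))"
  define K where "K = max (2 * M) (p - q)"
  have "p \<in> h ` ?F" unfolding p_def using \<open>finite A\<close> \<open>?F \<noteq> {}\<close> by (intro Max_in) auto
  then obtain f where f: "f \<in> A" "flip f" "h f = p" by blast
  have "q \<in> h ` ?F" unfolding q_def using \<open>finite A\<close> \<open>?F \<noteq> {}\<close> by (intro Min_in) auto
  then obtain g where g: "g \<in> A" "flip g" "h g = q" by blast
  have F: "q \<le> h a" "h a \<le> p" if "a \<in> A" "flip a" for a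
    using that \<open>finite A\<close> by (auto simp: p_def q_def)
  have T_le: "h a \<le> M" if "a \<in> A" "\<not> flip a" for a
    using that \<open>finite A\<close> by (auto simp: M_def intro!: Max_ge)
  \<comment> \<open>The inverse of a translation is a translation in \<open>A\<close> with the
    opposite value.\<close>
  have T: "\<bar>h a\<bar> \<le> M" if "a \<in> A" "\<not> flip a" for a
    using T_le[OF that] T_le[OF Ainv] that h_inv[of a] flip_inv[of a] AG by fastforce
  have "0 \<le> M" using \<open>finite A\<close> by (simp add: M_def)
  \<comment> \<open>The factor 2 avoids halves. A translation changes the value by at most
    \<open>M \<le> K / 2\<close>. A flip after an even number of flips adds at most
    \<open>p\<close>; the next flip turns this \<open>p\<close> into \<open>p - q \<le> K\<close>,
    which pays for two letters, hence the \<open>- 1\<close> in the odd case. The lower bound there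
    feeds the absolute value in the even case.\<close>
  have bound: "if flip (path_end G \<one> w)
      then 2 * (h (path_end G \<one> w) - p) \<le> (int (length w) - 1) * K \<and>
        2 * (q - h (path_end G \<one> w)) \<le> (int (length w) - 1) * K
      else 2 * \<bar>h (path_end G \<one> w)\<bar> \<le> int (length w) * K" if "w \<in> lists A" for w
    using that
  proof (induction w rule: rev_induct)
    case Nil
    then show ?case using flip_one h_one by simp
  next
    case (snoc a w)
    then have w: "path_end G \<one> w \<in> carrier G" "a \<in> A" "a \<in> carrier G" using closed AG by auto
    have K: "2 * M \<le> K" "p - q \<le> K" by (auto simp: K_def)
    show ?case
      using snoc K F[OF w(2)] T[OF w(2)]
      by (cases "flip (path_end G \<one> w)"; cases "flip a")
        (auto simp: flip[OF w(1,3)] h[OF w(1,3)] algebra_simps abs_if split: if_splits)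
  qed
  \<comment> \<open>With \<open>K = 0\<close> the bound would make \<open>h\<close> vanish on all
    translations, but \<open>h y0 \<noteq> 0\<close>.\<close>
  have "K > 0"
  proof (rule ccontr)
    assume "\<not> K > 0"
    have "K = 0" using \<open>\<not> K > 0\<close> \<open>0 \<le> M\<close> by (auto simp: K_def)
    obtain w where w: "w \<in> lists A" "path_end G \<one> w = y0"
      using word[OF \<open>y0 \<in> carrier G\<close>] by blast
    show False
      using bound[OF w(1)] w(2) \<open>K = 0\<close> \<open>\<not> flip y0\<close> \<open>h y0 \<noteq> 0\<close> by simp
  qed
  \<comment> \<open>For length 3 the odd bound is exactly \<open>p + K\<close>; as
    \<open>K > 0\<close>, shorter words cannot reach it.\<close>
  have geodesic: "w \<in> Geo G A"
    if "w \<in> lists A" "length w = 3" "flip (path_end G \<one> w)" "h (path_end G \<one> w) = p + K" for w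
  proof -
    have "3 \<le> length v" if "v \<in> lists A" "path_end G \<one> v = path_end G \<one> w" for v
    proof -
      have "2 * K \<le> (int (length v) - 1) * K"
        using bound[OF that(1)] that(2) \<open>flip (path_end G \<one> w)\<close> \<open>h (path_end G \<one> w) = p + K\<close> by simp
      then show ?thesis using \<open>K > 0\<close> by simp
    qed
    then show ?thesis using that(1,2) unfolding mem_Geo_iff[OF AG] by force
  qed
  have fG: "f \<in> carrier G" "g \<in> carrier G" using f g AG by auto
  show ?thesis
  proof (cases "p - q \<le> 2 * M")
    case True
    then have "K = 2 * M" by (simp add: K_def)
    have "M \<in> insert 0 (h ` ?T)" unfolding M_def using \<open>finite A\<close> by (intro Max_in) auto
    then obtain v where v: "v \<in> A" "\<not> flip v" "h v = M"
      using \<open>K = 2 * M\<close> \<open>K > 0\<close> by auto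
    then have "v \<in> carrier G" using AG by auto
    \<comment> \<open>The flip \<open>f\<close> reverses the sign of \<open>h (inv v) = - M\<close>,
      so the value is \<open>M + p + M = p + K\<close>.\<close>
    then have "[v, f, inv v] \<in> Geo G A"
      using v f fG Ainv flip_inv h_inv \<open>K = 2 * M\<close>
      by (intro geodesic) (auto simp: path_end_def flip h)
    moreover have "contains_generator_and_inverse G [v, f, inv v]"
      unfolding contains_generator_and_inverse_def by (rule exI[of _ 0], simp, rule exI[of _ 2], simp)
    ultimately show ?thesis by blast
  next
    case False
    then have "K = p - q" by (simp add: K_def)
    \<comment> \<open>A flip and its inverse have equal values, so the value is
      \<open>p - q + p = p + K\<close>.\<close>
    have "[f, g, inv f] \<in> Geo G A"
      using f g fG Ainv flip_inv h_inv \<open>K = p - q\<close>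
      by (intro geodesic) (auto simp: path_end_def flip h)
    moreover have "contains_generator_and_inverse G [f, g, inv f]"
      unfolding contains_generator_and_inverse_def by (rule exI[of _ 0], simp, rule exI[of _ 2], simp)
    ultimately show ?thesis by blast
  qed
qed

text \<open>Reduces \<open>h \<circ> \<phi> = - h\<close> to generators. Differences match
  \<open>frag_induction\<close>; supports lie in \<open>S\<close> because \<open>\<phi>\<close> is
  known to be additive only on the carrier.\<close>

lemma hom_free_Abelian_group_eqI:
  fixes f g :: "('a \<Rightarrow>\<^sub>0 int) \<Rightarrow> int"
  assumes f: "\<And>x y. Poly_Mapping.keys x \<subseteq> S \<Longrightarrow> Poly_Mapping.keys y \<subseteq> S \<Longrightarrow> f (x - y) = f x - f y"
    and g: "\<And>x y. Poly_Mapping.keys x \<subseteq> S \<Longrightarrow> Poly_Mapping.keys y \<subseteq> S \<Longrightarrow> g (x - y) = g x - g y"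
    and "\<And>k. k \<in> S \<Longrightarrow> f (frag_of k) = g (frag_of k)"
    and "Poly_Mapping.keys x \<subseteq> S"
  shows "f x = g x"
proof -
  have "Poly_Mapping.keys x \<subseteq> S \<and> f x = g x"
    using assms(4)
  proof (induction x rule: frag_induction)
    case zero
    then show ?case using f[of 0 0] g[of 0 0] by simp
  next
    case (one k)
    then show ?case using assms(3) by simp
  next
    case (diff a b)
    then show ?case using f g keys_diff[of a b] by auto
  qed
  then show ?thesis by simp
qed

theorem proposition3p9:
  fixes n :: nat
    and \<theta> :: "int \<Rightarrow> (nat \<Rightarrow>\<^sub>0 int) \<Rightarrow> (nat \<Rightarrow>\<^sub>0 int)"
    and \<phi> :: "(nat \<Rightarrow>\<^sub>0 int) \<Rightarrow> (nat \<Rightarrow>\<^sub>0 int)"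
    and G :: "((nat \<Rightarrow>\<^sub>0 int) \<times> int) monoid"
  assumes action: "\<theta> \<in> hom (integer_mod_group 2) (AutoGroup (free_abelian_rank n))"
    and phi: "\<phi> = \<theta> 1"
    and G: "G = semidirect_product (free_abelian_rank n) (integer_mod_group 2) \<theta>"
    and cases:
      "(\<exists>i\<in>{1..n}. \<phi> (frag_of i) = inv\<^bsub>free_abelian_rank n\<^esub> (frag_of i) \<and>
          (\<forall>k\<in>{1..n} - {i}. \<phi> (frag_of k) = frag_of k)) \<or>
       (\<exists>i\<in>{1..n}. \<exists>j\<in>{1..n}. i \<noteq> j \<and> \<phi> (frag_of i) = frag_of j \<and>
          (\<forall>k\<in>{1..n} - {i, j}. \<phi> (frag_of k) = frag_of k))"
  shows "\<forall>A. finite A \<and> symmetric_generating_set G A \<longrightarrow>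
    \<not> piecewise_excluding A (Geo G A) \<and>
    (\<exists>w\<in>Geo G A. contains_generator_and_inverse G w)"
proof -
  let ?N = "free_abelian_rank n" and ?H = "integer_mod_group 2"
  have N: "group ?N" by simp
  interpret G: group G
    unfolding G using N group_integer_mod_group action by (rule group_semidirect_product)
  have H: "0 \<in> carrier ?H" "1 \<in> carrier ?H" "carrier ?H = {0, 1}"
    by (auto simp: carrier_integer_mod_group)
  have mult_H: "x \<otimes>\<^bsub>?H\<^esub> y = (x + y) mod 2" for x y
    by (simp add: integer_mod_group_def)
  have aut: "\<theta> k \<in> hom ?N ?N" "\<theta> k \<in> Bij (carrier ?N)" if "k \<in> carrier ?H" for k
    using hom_in_carrier[OF action that] by (auto simp: AutoGroup_def auto_def)
  have \<theta>0: "\<theta> 0 x = x" if "Poly_Mapping.keys x \<subseteq> {1..n}" for x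
    using hom_one[OF action group_integer_mod_group group.AutoGroup[OF N]] that
    by (simp add: AutoGroup_def BijGroup_def)
  have involution: "\<phi> (\<phi> x) = x" if "Poly_Mapping.keys x \<subseteq> {1..n}" for x
    using hom_mult[OF action H(2) H(2)] aut[OF H(2)] that \<theta>0[OF that]
    by (simp add: AutoGroup_def BijGroup_def compose_def mult_H phi)
  have \<phi>_add: "\<phi> (x + y) = \<phi> x + \<phi> y"
    if "Poly_Mapping.keys x \<subseteq> {1..n}" "Poly_Mapping.keys y \<subseteq> {1..n}" for x y
    using hom_mult[OF aut(1)[OF H(2)], of x y] that by (simp add: phi)
  have \<phi>_diff: "\<phi> (x - y) = \<phi> x - \<phi> y"
    if "Poly_Mapping.keys x \<subseteq> {1..n}" "Poly_Mapping.keys y \<subseteq> {1..n}" for x y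
  proof -
    have "Poly_Mapping.keys (x - y) \<subseteq> {1..n}" using that keys_diff[of x y] by blast
    from \<phi>_add[OF this that(2)] show ?thesis by (simp add: algebra_simps)
  qed
  \<comment> \<open>The functional is the coordinate at \<open>i\<close> in the first case, and the
    coordinate at \<open>i\<close> minus that at \<open>j\<close> in the second.\<close>
  obtain h :: "(nat \<Rightarrow>\<^sub>0 int) \<Rightarrow> int" and i where
    h_add: "\<And>x y. h (x + y) = h x + h y" and i: "i \<in> {1..n}" and h_i: "h (frag_of i) = 1"
    and h_\<phi>_of: "\<And>k. k \<in> {1..n} \<Longrightarrow> h (\<phi> (frag_of k)) = - h (frag_of k)"
    using cases
  proof (elim disjE bexE conjE)
    fix i assume i: "i \<in> {1..n}" "\<phi> (frag_of i) = inv\<^bsub>?N\<^esub> (frag_of i)"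
      "\<forall>k\<in>{1..n} - {i}. \<phi> (frag_of k) = frag_of k"
    have "\<phi> (frag_of i) = - frag_of i" using i by simp
    with i(1,3) show thesis
      by (intro that[of "\<lambda>x. Poly_Mapping.lookup x i" i])
        (auto simp: lookup_add lookup_frag_of)
  next
    fix i j assume ij: "i \<in> {1..n}" "j \<in> {1..n}" "i \<noteq> j" "\<phi> (frag_of i) = frag_of j"
      "\<forall>k\<in>{1..n} - {i, j}. \<phi> (frag_of k) = frag_of k"
    \<comment> \<open>The image of the second swapped generator is forced by \<open>\<phi>\<close>
      being an involution.\<close>
    have "\<phi> (frag_of j) = frag_of i" using ij involution[of "frag_of i"] by simp
    with ij show thesis
      by (intro that[of "\<lambda>x. Poly_Mapping.lookup x i - Poly_Mapping.lookup x j" i])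
        (auto simp: lookup_add lookup_frag_of)
  qed
  have h_diff: "h (x - y) = h x - h y" for x y
    using h_add[of "x - y" y] by simp
  have h_\<phi>: "h (\<phi> x) = - h x" if "Poly_Mapping.keys x \<subseteq> {1..n}" for x
    by (rule hom_free_Abelian_group_eqI[of "{1..n}" "\<lambda>x. h (\<phi> x)" "\<lambda>x. - h x"])
      (use that in \<open>simp_all add: \<phi>_diff h_diff h_\<phi>_of\<close>)
  have witness: "\<exists>w\<in>Geo G A. contains_generator_and_inverse G w"
    if "finite A" "symmetric_generating_set G A" for A
  proof (rule G.Geo_contains_generator_and_inverse
      [where flip = "\<lambda>g. snd g = 1" and h = "\<lambda>g. h (fst g)" and ?x0.0 = "(0, 1)" and ?y0.0 = "(frag_of i, 0)"])
    fix x y assume "x \<in> carrier G" "y \<in> carrier G"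
    then show "snd (x \<otimes>\<^bsub>G\<^esub> y) = 1 \<longleftrightarrow> (snd x = 1) \<noteq> (snd y = 1)"
      "h (fst (x \<otimes>\<^bsub>G\<^esub> y)) = h (fst x) + (if snd x = 1 then - h (fst y) else h (fst y))"
      using H(3) by (cases x; cases y; auto simp: G mult_H h_add h_\<phi> \<theta>0 simp flip: phi)+
  qed (use that i h_i H in \<open>auto simp: G\<close>)
  show ?thesis
    using witness G.not_piecewise_excluding_Geo unfolding symmetric_generating_set_def by blast
qed

end
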